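(* Let $2\le k<r$ be fixed integers. For $n\ge 2$ let $H_r(n)$ be the ordered $r$-graph with vertex set $\{1<2<\dots<n\}$ whose edges are the sets $\{v_1,v_2,\dots,v_r\}$ with $v_1<v_2<\dots<v_r$ such that $v_{i+1}-v_i$ is a power of $2$ for every $i=1,\dots,r-k+1$. Define $d=d(n)$ by $e(H_r(n))=d\,n^{k-1}$. Then there is a constant $C$ depending only on $k$ and $r$ such that for every $n\ge 2$, every $m\le n$ and every interval $k$-partite subgraph $H'\subset H_r(n)$ with parts of size $m$, $$e(H')\le C\,\frac{d\,m^{k-1}}{\log n}.$$
   Context: An $r$-graph is a finite hypergraph all of whose edges have size $r$; $e(H)$ is the number of edges of $H$. An ordered $r$-graph is an $r$-graph with a linear ordering of its vertex set $V$. An interval in $V$ is a set of consecutive elements in the ordering; $A<B$ means $a<b$ for all $a\in A$, $b\in B$. Powers of $2$ are the integers $2^t$, $t\ge 0$. An ordered $r$-graph $H$ is interval $k$-partite if for some $\ell\ge k$ there are intervals $I_1<I_2<\cdots<I_\ell$ (the parts) of the vertex set such that every edge of $H$ is contained in $I_1\cup\dots\cup I_\ell$ and has nonempty intersection with $I_j$ for each $1\le j\le \ell$. *)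

theory Defs
  imports Complex_Main
begin

text \<open>An ordered hypergraph is a hypergraph whose vertices come from a linearly ordered type; its
  vertex set carries the induced ordering.\<close>

record 'a hypergraph =
  verts :: "'a set"
  edges :: "'a set set"

definition r_graph :: "nat \<Rightarrow> 'a hypergraph \<Rightarrow> bool" where
  "r_graph r H \<longleftrightarrow> finite (verts H) \<and> (\<forall>e\<in>edges H. e \<subseteq> verts H \<and> card e = r)"

definition num_edges :: "'a hypergraph \<Rightarrow> nat" where
  "num_edges H = card (edges H)"

definition subgraph :: "'a hypergraph \<Rightarrow> 'a hypergraph \<Rightarrow> bool" where
  "subgraph H' H \<longleftrightarrow> verts H' \<subseteq> verts H \<and> edges H' \<subseteq> edges H"

definition interval_in :: "'a::linorder set \<Rightarrow> 'a set \<Rightarrow> bool" where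
  "interval_in V I \<longleftrightarrow> I \<subseteq> V \<and> (\<forall>a\<in>I. \<forall>b\<in>I. \<forall>x\<in>V. a \<le> x \<and> x \<le> b \<longrightarrow> x \<in> I)"

definition set_before :: "'a::linorder set \<Rightarrow> 'a set \<Rightarrow> bool" where
  "set_before A B \<longleftrightarrow> (\<forall>a\<in>A. \<forall>b\<in>B. a < b)"

definition interval_parts :: "'a::linorder hypergraph \<Rightarrow> nat \<Rightarrow> (nat \<Rightarrow> 'a set) \<Rightarrow> bool" where
  "interval_parts H l I \<longleftrightarrow>
     (\<forall>j\<in>{1..l}. interval_in (verts H) (I j)) \<and>
     (\<forall>i\<in>{1..l}. \<forall>j\<in>{1..l}. i < j \<longrightarrow> set_before (I i) (I j)) \<and>
     (\<forall>e\<in>edges H. e \<subseteq> (\<Union>j\<in>{1..l}. I j) \<and> (\<forall>j\<in>{1..l}. e \<inter> I j \<noteq> {}))"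

definition interval_partite_of_size :: "nat \<Rightarrow> nat \<Rightarrow> 'a::linorder hypergraph \<Rightarrow> bool" where
  "interval_partite_of_size k m H \<longleftrightarrow>
     (\<exists>l\<ge>k. \<exists>I. interval_parts H l I \<and> (\<forall>j\<in>{1..l}. card (I j) = m))"

definition power_of_two :: "nat \<Rightarrow> bool" where
  "power_of_two x \<longleftrightarrow> (\<exists>t. x = 2 ^ t)"

definition pow2_graph :: "nat \<Rightarrow> nat \<Rightarrow> nat \<Rightarrow> nat hypergraph" where
  "pow2_graph k r n =
     \<lparr>verts = {1..n},
      edges = {v ` {1..r} | v :: nat \<Rightarrow> nat.
        (\<forall>i\<in>{1..r}. v i \<in> {1..n}) \<and>
        (\<forall>i\<in>{1..<r}. v i < v (i + 1)) \<and>
        (\<forall>i\<in>{1..r - k + 1}. power_of_two (v (i + 1) - v i))}\<rparr>"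

lemma r_graph_pow2_graph: "r_graph r (pow2_graph k r n)"
proof -
  have "card (v ` {1..r}) = r" if "\<forall>i\<in>{1..<r}. v i < v (i + 1)" for v :: "nat \<Rightarrow> nat"
  proof -
    have less: "j \<le> r \<longrightarrow> v i < v j" if "1 \<le> i" "Suc i \<le> j" for i j
      using that(2)
    proof (induction j rule: dec_induct)
      case base
      then show ?case using \<open>\<forall>i\<in>{1..<r}. v i < v (i + 1)\<close> that(1) by auto
    next
      case (step j)
      then have "j + 1 \<le> r \<longrightarrow> v j < v (j + 1)"
        using \<open>\<forall>i\<in>{1..<r}. v i < v (i + 1)\<close> that(1) by auto
      then show ?case using step by auto
    qed
    have "inj_on v {1..r}"
    proof (rule linorder_inj_onI)
      fix i j assume "i < j" "i \<in> {1..r}" "j \<in> {1..r}"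
      then show "v i \<noteq> v j" using less[of i j] by auto
    qed auto
    then show ?thesis by (simp add: card_image)
  qed
  then show ?thesis
    by (auto simp: r_graph_def pow2_graph_def)
qed

end

theory Submission
  imports Defs "HOL-Library.FuncSet"
begin

text \<open>Put \<open>s = r - k + 1\<close>. Choosing the first vertex, \<open>s\<close> exponents and the remaining \<open>k - 2\<close>
  vertices freely shows that \<open>d\<close> is at least of order \<open>(log n)\<^sup>s\<close>. In an interval \<open>k\<close>-partite
  subgraph the last \<open>k - 2\<close> vertices of an edge cannot meet all parts after the first, so one of the
  \<open>s\<close> power-of-two gaps leads from the first part to the second. There are only \<open>O(m)\<close> pairs in
  these two parts whose difference is a power of two, instead of the \<open>O(m log n)\<close> obtained by choosing a
  vertex and an exponent; this saves the factor \<open>log n\<close>. The bound on pairs holds for arbitrary sets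
  \<open>A < B\<close> of size \<open>m\<close>, which matters because the parts are intervals of the vertex set of the
  subgraph, not necessarily of \<open>{1..n}\<close>.\<close>

section \<open>Increasing enumerations of edges\<close>

lemma chain_less:
  fixes v :: "nat \<Rightarrow> nat"
  assumes "\<forall>i\<in>{1..<r}. v i < v (i + 1)" and "1 \<le> i" and "i < j" and "j \<le> r"
  shows "v i < v j"
  using assms(3,4)
proof (induction j)
  case 0
  then show ?case by simp
next
  case (Suc j)
  then have "v j < v (j + 1)" using assms(1,2) by auto
  with Suc show ?case by (cases "i = j") auto
qed

text \<open>Induction on \<open>i\<close>: once all smaller indices agree, \<open>v i\<close> must
  be some \<open>w j\<close> with \<open>j \<ge> i\<close>, so \<open>w i \<le> v i\<close>; the
  situation is symmetric. This lets edges be counted through their enumerations.\<close>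

lemma chain_eq_of_image_eq:
  fixes v w :: "nat \<Rightarrow> nat"
  assumes v: "\<forall>i\<in>{1..<r}. v i < v (i + 1)" and w: "\<forall>i\<in>{1..<r}. w i < w (i + 1)"
    and eq: "v ` {1..r} = w ` {1..r}" and "i \<in> {1..r}"
  shows "v i = w i"
  using assms(4)
proof (induction i rule: less_induct)
  case (less i)
  have aux: "b i \<le> a i"
    if b: "\<forall>i\<in>{1..<r}. b i < b (i + 1)"
      and ab: "a ` {1..r} = b ` {1..r}" and a: "\<forall>i\<in>{1..<r}. a i < a (i + 1)"
      and IH: "\<And>j. j < i \<Longrightarrow> j \<in> {1..r} \<Longrightarrow> a j = b j"
    for a b :: "nat \<Rightarrow> nat"
  proof -
    obtain j where j: "j \<in> {1..r}" "a i = b j" using ab less.prems by blast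
    have "\<not> j < i"
    proof
      assume "j < i"
      then have "a j < a i" using chain_less[OF a, of j i] j less.prems by auto
      with IH[OF \<open>j < i\<close> j(1)] j show False by simp
    qed
    then show ?thesis
      using chain_less[OF b, of i j] j less.prems by (cases "i = j") auto
  qed
  show ?case
    using aux[OF w eq v] aux[OF v eq[symmetric] w] less by (intro antisym) auto
qed

section \<open>Pairs at power-of-two distance\<close>

text \<open>If \<open>2 ^ t\<close> is the least power of two that is at least \<open>c\<close>,
  then \<open>2 ^ (t + 2) \<ge> 4 * c\<close> already exceeds \<open>2 * c\<close>. Both remaining
  candidates occur when \<open>c\<close> is itself a power of two.\<close>

lemma card_power_of_two_dyadic:
  assumes "0 < c"
  shows "finite {z. power_of_two z \<and> c \<le> z \<and> z \<le> 2 * c}"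
    and "card {z. power_of_two z \<and> c \<le> z \<and> z \<le> 2 * c} \<le> 2"
proof -
  define t where "t = (LEAST t. c \<le> 2 ^ t)"
  have ct: "c \<le> 2 ^ t" unfolding t_def
    by (rule LeastI[of _ c]) (simp add: less_imp_le)
  have sub: "{z. power_of_two z \<and> c \<le> z \<and> z \<le> 2 * c} \<subseteq> {2 ^ t, 2 ^ (t + 1)}"
  proof
    fix z assume "z \<in> {z. power_of_two z \<and> c \<le> z \<and> z \<le> 2 * c}"
    then obtain u where u: "z = 2 ^ u" "c \<le> 2 ^ u" "2 ^ u \<le> 2 * c"
      by (auto simp: power_of_two_def)
    have "t \<le> u" unfolding t_def using u(2) by (rule Least_le)
    moreover have "u < t + 2"
    proof (rule ccontr)
      assume "\<not> u < t + 2"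
      then have "(2::nat) ^ (t + 2) \<le> 2 ^ u" by (intro power_increasing) auto
      with u(3) ct assms show False by simp
    qed
    ultimately have "u = t \<or> u = t + 1" by auto
    with u(1) show "z \<in> {2 ^ t, 2 ^ (t + 1)}" by auto
  qed
  then show "finite {z. power_of_two z \<and> c \<le> z \<and> z \<le> 2 * c}"
    by (rule finite_subset) simp
  have "card {z. power_of_two z \<and> c \<le> z \<and> z \<le> 2 * c} \<le> card {2 ^ t, 2 ^ (t + 1) :: nat}"
    using sub by (intro card_mono) auto
  also have "\<dots> \<le> 2" by simp
  finally show "card {z. power_of_two z \<and> c \<le> z \<and> z \<le> 2 * c} \<le> 2" .
qed

text \<open>Measure positions from a separating point: the difference is then a power of two between
  \<open>c\<close> and \<open>2 * c\<close>, where \<open>c\<close> is the distance of the farther endpoint, so the farther endpoint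
  leaves at most two choices for the other one.\<close>

lemma card_power_of_two_pairs:
  fixes A B :: "nat set"
  assumes A: "finite A" and B: "finite B" and AB: "set_before A B"
  shows "card {(x, y). x \<in> A \<and> y \<in> B \<and> power_of_two (y - x)} \<le> 2 * card A + 2 * card B"
proof (cases "A = {}")
  case False
  define p where "p = Max A"
  define D where "D c = {z. power_of_two z \<and> c \<le> z \<and> z \<le> 2 * c}" for c :: nat
  have D: "finite (D c)" "card (D c) \<le> 2" if "0 < c" for c
    using card_power_of_two_dyadic[OF that] by (simp_all add: D_def)
  \<comment> \<open>The dyadic bound needs a positive \<open>c\<close>, so \<open>x = p\<close> is
    left out of \<open>P1\<close>; pairs with \<open>x = p\<close> fall into \<open>P2\<close>,
    where \<open>y - p\<close> is always positive.\<close>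
  define A' where "A' = {x \<in> A. x < p}"
  define P1 where "P1 = (\<Union>x\<in>A'. (\<lambda>z. (x, x + z)) ` D (p - x))"
  define P2 where "P2 = (\<Union>y\<in>B. (\<lambda>z. (y - z, y)) ` D (y - p))"
  have pA: "p \<in> A" using A False by (simp add: p_def)
  have pB: "p < y" if "y \<in> B" for y using AB pA that by (auto simp: set_before_def)
  have fA': "finite A'" and cA': "card A' \<le> card A"
    using A by (auto simp: A'_def intro: card_mono)
  have sub: "{(x, y). x \<in> A \<and> y \<in> B \<and> power_of_two (y - x)} \<subseteq> P1 \<union> P2"
  proof clarify
    fix x y assume xy: "x \<in> A" "y \<in> B" "power_of_two (y - x)" "(x, y) \<notin> P2"
    have "x \<le> p" using A xy(1) by (simp add: p_def)
    have "p < y" using pB xy(2) .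
    show "(x, y) \<in> P1"
    proof (cases "p - x \<le> y - p")
      case True
      then have "y - x \<in> D (y - p)" using xy \<open>x \<le> p\<close> \<open>p < y\<close> by (auto simp: D_def)
      then have "(y - (y - x), y) \<in> P2" using xy(2) unfolding P2_def by blast
      with xy(4) \<open>x \<le> p\<close> \<open>p < y\<close> show ?thesis by simp
    next
      case False
      then have "y - x \<in> D (p - x)" "x \<in> A'"
        using xy \<open>x \<le> p\<close> \<open>p < y\<close> by (auto simp: D_def A'_def)
      then have "(x, x + (y - x)) \<in> P1" unfolding P1_def by blast
      with \<open>x \<le> p\<close> \<open>p < y\<close> show ?thesis by simp
    qed
  qed
  have "card P1 \<le> (\<Sum>x\<in>A'. card ((\<lambda>z. (x, x + z)) ` D (p - x)))"
    unfolding P1_def by (rule card_UN_le[OF fA'])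
  also have "\<dots> \<le> (\<Sum>x\<in>A'. 2)"
    by (intro sum_mono order_trans[OF card_image_le]) (auto simp: A'_def D)
  finally have c1: "card P1 \<le> 2 * card A" using cA' by simp
  have "card P2 \<le> (\<Sum>y\<in>B. card ((\<lambda>z. (y - z, y)) ` D (y - p)))"
    unfolding P2_def by (rule card_UN_le[OF B])
  also have "\<dots> \<le> (\<Sum>y\<in>B. 2)"
    using pB by (intro sum_mono order_trans[OF card_image_le]) (auto simp: D)
  finally have c2: "card P2 \<le> 2 * card B" by simp
  have "finite P1" "finite P2"
    using fA' B D pB by (auto simp: P1_def P2_def A'_def)
  then have "card {(x, y). x \<in> A \<and> y \<in> B \<and> power_of_two (y - x)} \<le> card (P1 \<union> P2)"
    by (intro card_mono sub) auto
  also have "\<dots> \<le> card P1 + card P2" by (rule card_Un_le)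
  finally show ?thesis using c1 c2 by linarith
qed simp

section \<open>How an edge passes from the first part to the second\<close>

text \<open>A choice of one point of \<open>X\<close> in each \<open>I j\<close> is injective by
  disjointness. This serves twice: to show that too few vertices remain for the later parts, and to
  bound the number of parts by \<open>r\<close>.\<close>

lemma card_le_of_hits_disjoint:
  assumes "finite X" and hit: "\<And>j. j \<in> J \<Longrightarrow> X \<inter> I j \<noteq> {}"
    and disj: "\<And>i j. i \<in> J \<Longrightarrow> j \<in> J \<Longrightarrow> i \<noteq> j \<Longrightarrow> I i \<inter> I j = {}"
  shows "card J \<le> card X"
proof -
  define c where "c j = (SOME x. x \<in> X \<inter> I j)" for j
  have c: "c j \<in> X \<inter> I j" if "j \<in> J" for j
    unfolding c_def some_in_eq using hit[OF that] .
  have "inj_on c J"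
  proof (rule inj_onI, rule ccontr)
    fix i j assume "i \<in> J" "j \<in> J" "c i = c j" "i \<noteq> j"
    then show False using c[of i] c[of j] disj[of i j] by auto
  qed
  then show ?thesis using c by (intro card_inj_on_le[of c J X] assms(1)) auto
qed

lemma disjoint_of_set_before:
  fixes I :: "nat \<Rightarrow> 'a::linorder set"
  assumes "\<forall>i\<in>J. \<forall>j\<in>J. i < j \<longrightarrow> set_before (I i) (I j)"
    and "i \<in> J" and "j \<in> J" and "i \<noteq> j"
  shows "I i \<inter> I j = {}"
  using assms unfolding set_before_def by (metis disjoint_iff less_irrefl linorder_neqE_nat)

text \<open>Take the first step at which the enumeration leaves \<open>I 1\<close>. It starts in
  \<open>I 1\<close>, since a vertex of a later part cannot precede one of \<open>I 1\<close>. It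
  cannot jump over \<open>I 2\<close>, since a vertex of the edge in \<open>I 2\<close> would then
  come earlier and so lie in \<open>I 1\<close>.\<close>

lemma first_crossing:
  fixes v :: "nat \<Rightarrow> nat"
  assumes v: "\<forall>i\<in>{1..<r}. v i < v (i + 1)"
    and before: "\<forall>i\<in>{1..l}. \<forall>j\<in>{1..l}. i < j \<longrightarrow> set_before (I i) (I j)"
    and cover: "v ` {1..r} \<subseteq> (\<Union>j\<in>{1..l}. I j)"
    and hit: "\<forall>j\<in>{1..l}. v ` {1..r} \<inter> I j \<noteq> {}"
    and k: "2 \<le> k" "k < r" "k \<le> l"
  shows "\<exists>i\<in>{1..r - k + 1}. v i \<in> I 1 \<and> v (i + 1) \<in> I 2"
proof -
  have disj: "I i \<inter> I j = {}" if "i \<in> {1..l}" "j \<in> {1..l}" "i \<noteq> j" for i j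
    using disjoint_of_set_before[OF before that] .
  have part: "\<exists>j\<in>{1..l}. v a \<in> I j" if "a \<in> {1..r}" for a
    using cover that by blast
  have v1: "v 1 \<in> I 1"
  proof -
    obtain a where a: "a \<in> {1..r}" "v a \<in> I 1" using hit k by fastforce
    obtain j where j: "j \<in> {1..l}" "v 1 \<in> I j" using part[of 1] k by auto
    have "v 1 \<le> v a" using chain_less[OF v, of 1 a] a by (cases "a = 1") auto
    then have "\<not> set_before (I 1) (I j)" using a j by (force simp: set_before_def)
    then have "\<not> 1 < j" using before j k by auto
    then have "j = 1" using j by auto
    with j show ?thesis by simp
  qed
  have "\<exists>i. i \<in> {1..r - k + 1} \<and> v (i + 1) \<notin> I 1"
  proof (rule ccontr)
    assume no: "\<not> ?thesis"
    have in1: "v a \<in> I 1" if "a \<in> {1..r - k + 2}" for a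
      using no v1 that by (cases "a = 1") (auto dest: spec[of _ "a - 1"])
    \<comment> \<open>With the first \<open>r - k + 2\<close> vertices in \<open>I 1\<close>, only
      \<open>k - 2\<close> vertices are left to meet the \<open>l - 1 \<ge> k - 1\<close> later
      parts.\<close>
    have "card {2..l} \<le> card (v ` {r - k + 3..r})"
    proof (rule card_le_of_hits_disjoint[where I = I])
      fix j assume j: "j \<in> {2..l}"
      then obtain a where a: "a \<in> {1..r}" "v a \<in> I j" using hit by fastforce
      have "a \<notin> {1..r - k + 2}" using in1[of a] disj[of 1 j] j a k by auto
      then have "a \<in> {r - k + 3..r}" using a by auto
      with a show "v ` {r - k + 3..r} \<inter> I j \<noteq> {}" by blast
    qed (auto simp: disj)
    also have "\<dots> \<le> card {r - k + 3..r}" by (rule card_image_le) simp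
    finally show False using k by simp
  qed
  define i where "i = (LEAST i. i \<in> {1..r - k + 1} \<and> v (i + 1) \<notin> I 1)"
  have i: "i \<in> {1..r - k + 1}" "v (i + 1) \<notin> I 1"
    using LeastI_ex[OF \<open>\<exists>i. _ i\<close>] unfolding i_def by auto
  have min: "v (a + 1) \<in> I 1" if "a \<in> {1..<i}" for a
    using not_less_Least[of a "\<lambda>i. i \<in> {1..r - k + 1} \<and> v (i + 1) \<notin> I 1"] that i
    unfolding i_def[symmetric] by auto
  have in1: "v a \<in> I 1" if "a \<in> {1..i}" for a
    using min[of "a - 1"] v1 that by (cases "a = 1") (simp_all, arith)
  have "i + 1 \<in> {1..r}" using i k by auto
  then obtain j where j: "j \<in> {1..l}" "v (i + 1) \<in> I j" using part by blast
  have "\<not> 2 < j"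
  proof
    assume "2 < j"
    obtain a where a: "a \<in> {1..r}" "v a \<in> I 2" using hit k by fastforce
    have "set_before (I 2) (I j)" using before \<open>2 < j\<close> j k by auto
    then have "v a < v (i + 1)" using a j by (auto simp: set_before_def)
    then have "a \<le> i" using chain_less[OF v, of "i + 1" a] a by (cases "a = i + 1") force+
    then have "v a \<in> I 1" using in1[of a] a by auto
    then show False using disj[of 1 2] a k by auto
  qed
  then have "j = 2" using j i by (cases "j = 1") auto
  then show ?thesis using i in1[of i] j by auto
qed

section \<open>Upper bound for interval partite subgraphs\<close>

lemma chain_telescope:
  fixes v :: "nat \<Rightarrow> nat"
  assumes "a \<le> b" and "\<And>l. a \<le> l \<Longrightarrow> l < b \<Longrightarrow> v (l + 1) = v l + g l"
  shows "v b = v a + (\<Sum>l\<in>{a..<b}. g l)"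
  using assms by (induction b rule: dec_induct) auto

text \<open>An edge is recovered from its crossing pair, the exponents of the other
  \<open>s - 1\<close> early gaps and its last \<open>r - s - 1\<close> vertices. Recording the pair
  itself, rather than one endpoint and an exponent, avoids one factor \<open>M\<close>.\<close>

lemma card_edges_through_crossing:
  fixes A B U :: "nat set" and M r s i :: nat
  assumes fin: "finite A" "finite B" "finite U" and AB: "set_before A B"
    and i: "i \<in> {1..s}" and s: "s < r"
  defines "E \<equiv> {v ` {1..r} | v. (\<forall>j\<in>{1..s}. \<exists>t<M. v (j + 1) = v j + 2 ^ t) \<and>
      v i \<in> A \<and> v (i + 1) \<in> B \<and> (\<forall>j\<in>{s + 2..r}. v j \<in> U)}"
  shows "finite E" and "card E \<le> (2 * card A + 2 * card B) * (M ^ (s - 1) * card U ^ (r - s - 1))"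
proof -
  define P where "P = {(x, y). x \<in> A \<and> y \<in> B \<and> power_of_two (y - x)}"
  \<comment> \<open>Indices up to \<open>s\<close> carry gap exponents, those from
    \<open>s + 2\<close> on carry vertices. Index \<open>s + 1\<close> is absent: that vertex is
    reached from the pair by adding gaps.\<close>
  define J where "J = ({1..s} - {i}) \<union> {s + 2..r}"
  define F where "F j = (if j \<le> s then {..<M} else U)" for j
  \<comment> \<open>Decoding: walk left from \<open>x\<close> by subtracting gaps and right from
    \<open>y\<close> by adding them. For an upper bound it suffices that every edge is decoded from
    some code.\<close>
  define W where "W j = (\<lambda>((x, y), f). if j \<le> i then x - (\<Sum>l\<in>{j..<i}. 2 ^ f l)
      else if j \<le> s + 1 then y + (\<Sum>l\<in>{i + 1..<j}. 2 ^ f l) else f j)"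
    for j :: nat
  define Q where "Q = P \<times> PiE J F"
  have finP: "finite P"
    by (rule finite_subset[of _ "A \<times> B"]) (auto simp: P_def fin)
  have finQ: "finite Q"
    unfolding Q_def by (intro finite_cartesian_product finP finite_PiE) (auto simp: J_def F_def fin)
  have sub: "E \<subseteq> (\<lambda>a. (\<lambda>j. W j a) ` {1..r}) ` Q"
  proof
    fix e assume "e \<in> E"
    then obtain v where e: "e = v ` {1..r}"
      and gap: "\<forall>j\<in>{1..s}. \<exists>t<M. v (j + 1) = v j + 2 ^ t"
      and vA: "v i \<in> A" and vB: "v (i + 1) \<in> B" and vU: "\<forall>j\<in>{s + 2..r}. v j \<in> U"
      unfolding E_def by blast
    obtain t where t: "\<And>j. j \<in> {1..s} \<Longrightarrow> t j < M \<and> v (j + 1) = v j + 2 ^ t j"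
      using gap by metis
    define f where "f = restrict (\<lambda>j. if j \<le> s then t j else v j) J"
    have "(v i, v (i + 1)) \<in> P"
      using vA vB t[OF i] by (auto simp: P_def power_of_two_def)
    moreover have "f \<in> PiE J F"
      unfolding f_def using t vU by (auto simp: J_def F_def)
    ultimately have inQ: "((v i, v (i + 1)), f) \<in> Q" by (simp add: Q_def)
    have "W j ((v i, v (i + 1)), f) = v j" if j: "j \<in> {1..r}" for j
    proof -
      \<comment> \<open>Since \<open>f\<close> stores no exponent at \<open>i\<close>, telescoping
        is done only on ranges that avoid the crossing gap.\<close>
      have tel: "v b = v a + (\<Sum>l\<in>{a..<b}. 2 ^ f l)"
        if "1 \<le> a" "a \<le> b" "b \<le> s + 1" "i \<notin> {a..<b}" for a b
      proof (rule chain_telescope[OF \<open>a \<le> b\<close>])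
        fix l assume l: "a \<le> l" "l < b"
        then have "l \<in> J" "l \<in> {1..s}" using that by (auto simp: J_def)
        then show "v (l + 1) = v l + 2 ^ f l" using t[of l] by (simp add: f_def)
      qed
      consider "j \<le> i" | "i < j" "j \<le> s + 1" | "s + 1 < j" by linarith
      then show ?thesis
      proof cases
        case 1
        then show ?thesis using tel[of j i] i j by (simp add: W_def)
      next
        case 2
        then show ?thesis using tel[of "i + 1" j] by (simp add: W_def)
      next
        case 3
        then show ?thesis using i j by (simp add: W_def f_def J_def)
      qed
    qed
    then have "e = (\<lambda>j. W j ((v i, v (i + 1)), f)) ` {1..r}"
      unfolding e by (intro image_cong) auto
    with inQ show "e \<in> (\<lambda>a. (\<lambda>j. W j a) ` {1..r}) ` Q" by blast
  qed
  show "finite E" by (rule finite_subset[OF sub]) (simp add: finQ)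
  have "card E \<le> card ((\<lambda>a. (\<lambda>j. W j a) ` {1..r}) ` Q)"
    by (rule card_mono[OF _ sub]) (simp add: finQ)
  also have "\<dots> \<le> card Q" by (rule card_image_le[OF finQ])
  also have "card Q = card P * (\<Prod>j\<in>J. card (F j))"
    unfolding Q_def by (simp add: card_cartesian_product card_PiE J_def)
  also have "(\<Prod>j\<in>J. card (F j)) = (\<Prod>j\<in>{1..s} - {i}. card (F j)) * (\<Prod>j\<in>{s + 2..r}. card (F j))"
    unfolding J_def by (rule prod.union_disjoint) auto
  also have "(\<Prod>j\<in>{1..s} - {i}. card (F j)) = (\<Prod>j\<in>{1..s} - {i}. M)"
    by (intro prod.cong) (auto simp: F_def)
  also have "\<dots> = M ^ (s - 1)" using i by simp
  also have "(\<Prod>j\<in>{s + 2..r}. card (F j)) = (\<Prod>j\<in>{s + 2..r}. card U)"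
    by (intro prod.cong) (auto simp: F_def)
  also have "\<dots> = card U ^ (r - s - 1)" using s by (simp add: Suc_diff_le)
  also have "card P * (M ^ (s - 1) * card U ^ (r - s - 1))
      \<le> (2 * card A + 2 * card B) * (M ^ (s - 1) * card U ^ (r - s - 1))"
    using card_power_of_two_pairs[OF fin(1,2) AB] by (intro mult_right_mono) (auto simp: P_def)
  finally show "card E \<le> (2 * card A + 2 * card B) * (M ^ (s - 1) * card U ^ (r - s - 1))" .
qed

text \<open>Sum the previous bound over the possible crossing gaps. Gaps are at most
  \<open>n < 2 ^ M\<close>, so exponents stay below \<open>M\<close>; the last vertices range over
  the union of the parts, which has at most \<open>r * m\<close> elements.\<close>

lemma num_edges_interval_partite_le:
  fixes H' :: "nat hypergraph"
  assumes k: "2 \<le> k" "k < r" and n: "n < 2 ^ M" and H': "r_graph r H'"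
    and sub: "subgraph H' (pow2_graph k r n)" and part: "interval_partite_of_size k m H'"
  shows "num_edges H' \<le> (r - k + 1) * (4 * m * (M ^ (r - k) * (r * m) ^ (k - 2)))"
proof (cases "edges H' = {}")
  case False
  define s where "s = r - k + 1"
  obtain l I where l: "k \<le> l" and parts: "interval_parts H' l I"
    and card: "\<forall>j\<in>{1..l}. card (I j) = m"
    using part unfolding interval_partite_of_size_def by blast
  have int: "\<forall>j\<in>{1..l}. interval_in (verts H') (I j)"
    and before: "\<forall>i\<in>{1..l}. \<forall>j\<in>{1..l}. i < j \<longrightarrow> set_before (I i) (I j)"
    and cover: "\<forall>e\<in>edges H'. e \<subseteq> (\<Union>j\<in>{1..l}. I j) \<and> (\<forall>j\<in>{1..l}. e \<inter> I j \<noteq> {})"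
    using parts unfolding interval_parts_def by simp_all
  have finV: "finite (verts H')" using H' by (simp add: r_graph_def)
  have finI: "finite (I j)" if "j \<in> {1..l}" for j
    using int[rule_format, OF that] finV unfolding interval_in_def by (blast intro: finite_subset)
  have disj: "I i \<inter> I j = {}" if "i \<in> {1..l}" "j \<in> {1..l}" "i \<noteq> j" for i j
    using disjoint_of_set_before[OF before that] .
  \<comment> \<open>An edge is what bounds the number of parts: its \<open>r\<close> vertices meet
    \<open>l\<close> disjoint sets. Without edges \<open>l\<close> could be arbitrarily
    large.\<close>
  obtain e where e: "e \<in> edges H'" using False by blast
  have "e \<subseteq> verts H'" "card e = r" using H' e by (simp_all add: r_graph_def)
  then have "finite e" "card e = r" using finV by (simp_all add: finite_subset)
  then have lr: "l \<le> r"
    using card_le_of_hits_disjoint[of e "{1..l}" I] cover e disj by simp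
  define U where "U = (\<Union>j\<in>{1..l}. I j)"
  have finU: "finite U" using finI by (simp add: U_def)
  have "card U \<le> (\<Sum>j\<in>{1..l}. card (I j))" unfolding U_def by (rule card_UN_le) simp
  also have "\<dots> = l * m" using card by simp
  also have "\<dots> \<le> r * m" using lr by simp
  finally have cU: "card U \<le> r * m" .
  define E where "E i = {v ` {1..r} | v. (\<forall>j\<in>{1..s}. \<exists>t<M. v (j + 1) = v j + 2 ^ t) \<and>
      v i \<in> I 1 \<and> v (i + 1) \<in> I 2 \<and> (\<forall>j\<in>{s + 2..r}. v j \<in> U)}" for i
  have two: "1 \<in> {1..l}" "2 \<in> {1..l}" using k l by auto
  have E: "finite (E i)" "card (E i) \<le> 4 * m * (M ^ (r - k) * (r * m) ^ (k - 2))"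
    if i: "i \<in> {1..s}" for i
  proof -
    have sr: "s < r" using k by (simp add: s_def)
    have b: "set_before (I 1) (I 2)" using before two by auto
    note * = card_edges_through_crossing[OF finI[OF two(1)] finI[OF two(2)] finU b i sr,
        of M, folded E_def]
    show "finite (E i)" by (rule *(1))
    have "card (E i) \<le> (2 * card (I 1) + 2 * card (I 2)) * (M ^ (s - 1) * card U ^ (r - s - 1))"
      by (rule *(2))
    also have "\<dots> = 4 * m * (M ^ (r - k) * card U ^ (k - 2))"
    proof -
      have "s - 1 = r - k" "r - s - 1 = k - 2" using k by (auto simp: s_def)
      moreover have "card (I 1) = m" "card (I 2) = m" using card two by auto
      ultimately show ?thesis by simp
    qed
    also have "\<dots> \<le> 4 * m * (M ^ (r - k) * (r * m) ^ (k - 2))"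
      using cU by (intro mult_left_mono power_mono) auto
    finally show "card (E i) \<le> 4 * m * (M ^ (r - k) * (r * m) ^ (k - 2))" .
  qed
  have "edges H' \<subseteq> (\<Union>i\<in>{1..s}. E i)"
  proof
    fix e assume e: "e \<in> edges H'"
    then have "e \<in> edges (pow2_graph k r n)" using sub by (auto simp: subgraph_def)
    then obtain v where v: "e = v ` {1..r}" "\<forall>i\<in>{1..r}. v i \<in> {1..n}"
      "\<forall>i\<in>{1..<r}. v i < v (i + 1)" "\<forall>i\<in>{1..r - k + 1}. power_of_two (v (i + 1) - v i)"
      unfolding pow2_graph_def by auto
    have cov: "v ` {1..r} \<subseteq> (\<Union>j\<in>{1..l}. I j)" "\<forall>j\<in>{1..l}. v ` {1..r} \<inter> I j \<noteq> {}"
      using cover e v(1) by blast+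
    obtain i where i: "i \<in> {1..s}" "v i \<in> I 1" "v (i + 1) \<in> I 2"
      using first_crossing[OF v(3) before cov k l] unfolding s_def by blast
    have "\<exists>t<M. v (j + 1) = v j + 2 ^ t" if j: "j \<in> {1..s}" for j
    proof -
      obtain t where t: "v (j + 1) - v j = 2 ^ t"
        using v(4) j unfolding s_def power_of_two_def by blast
      have j': "j \<in> {1..<r}" "j + 1 \<in> {1..r}" using j k by (auto simp: s_def)
      have "v j < v (j + 1)" using v(3) j'(1) by blast
      have "v (j + 1) \<le> n" using v(2) j'(2) by fastforce
      then have "(2::nat) ^ t < 2 ^ M" using t n by linarith
      then have "t < M" by (simp add: power_strict_increasing_iff)
      moreover have "v (j + 1) = v j + 2 ^ t" using t \<open>v j < v (j + 1)\<close> by linarith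
      ultimately show ?thesis by blast
    qed
    moreover have "\<forall>j\<in>{s + 2..r}. v j \<in> U" using cov(1) unfolding U_def by fastforce
    ultimately have "e \<in> E i" unfolding E_def v(1) using i by blast
    with i show "e \<in> (\<Union>i\<in>{1..s}. E i)" by blast
  qed
  then have "card (edges H') \<le> card (\<Union>i\<in>{1..s}. E i)"
    by (intro card_mono) (auto simp: E)
  also have "\<dots> \<le> (\<Sum>i\<in>{1..s}. card (E i))" by (rule card_UN_le) simp
  also have "\<dots> \<le> (\<Sum>i\<in>{1..s}. 4 * m * (M ^ (r - k) * (r * m) ^ (k - 2)))"
    by (intro sum_mono E)
  also have "\<dots> = s * (4 * m * (M ^ (r - k) * (r * m) ^ (k - 2)))" by simp
  finally show ?thesis by (simp add: num_edges_def s_def)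
qed (simp add: num_edges_def)

section \<open>Lower bound for the number of edges of the whole graph\<close>

lemma finite_edges_pow2_graph: "finite (edges (pow2_graph k r n))"
  by (rule finite_subset[of _ "Pow {1..n}"]) (auto simp: pow2_graph_def)

text \<open>Choose a first vertex in \<open>{1..q}\<close>, then \<open>s\<close> exponents below
  \<open>T\<close>, then one vertex in each of \<open>k - 2\<close> consecutive blocks of length
  \<open>q\<close>. The power-of-two gaps add up to at most \<open>q\<close>, so the first
  \<open>s + 1\<close> vertices stay within \<open>{1..2 * q}\<close>, before these blocks.\<close>

lemma num_edges_pow2_graph_ge:
  assumes k: "2 \<le> k" "k < r" and q: "k * q \<le> n" and T: "(r - k + 1) * 2 ^ T \<le> q"
  shows "q ^ (k - 1) * T ^ (r - k + 1) \<le> num_edges (pow2_graph k r n)"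
proof -
  define s where "s = r - k + 1"
  have rs: "r = s + k - 1" using k by (simp add: s_def)
  \<comment> \<open>Entry 1 is the first vertex, entries \<open>2\<close> to \<open>s + 1\<close>
    are the exponents of the gaps ending at these indices, and later entries are offsets inside
    blocks. Offsets start at 1, which makes the passage into each new block strict.\<close>
  define F where "F j = (if j \<in> {2..s + 1} then {..<T} else {1..q})" for j :: nat
  define V where "V f j = (if j \<le> s + 1 then f 1 + (\<Sum>l\<in>{2..j}. 2 ^ f l) else (j - s) * q + f j)"
    for f :: "nat \<Rightarrow> nat" and j
  define Q where "Q = PiE {1..r} F"
  have fF: "f j \<in> F j" if "f \<in> Q" "j \<in> {1..r}" for f j
    using that by (auto simp: Q_def)
  have f1: "f 1 \<in> {1..q}" if "f \<in> Q" for f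
    using fF[OF that, of 1] k by (simp add: F_def)
  have fT: "f j < T" if "f \<in> Q" "j \<in> {2..s + 1}" for f j
  proof -
    have "j \<in> {1..r}" using that(2) k rs by auto
    from fF[OF that(1) this] that(2) show ?thesis by (simp add: F_def)
  qed
  have fq: "f j \<in> {1..q}" if "f \<in> Q" "j \<in> {s + 2..r}" for f j
    using fF[OF that(1), of j] that(2) by (simp add: F_def)
  have step: "V f (j + 1) = V f j + 2 ^ f (j + 1)" if "j \<in> {1..s}" for f j
    using that by (simp add: V_def)
  have Vle: "V f j \<le> 2 * q" if f: "f \<in> Q" and j: "j \<in> {1..s + 1}" for f j
  proof -
    have "(\<Sum>l\<in>{2..j}. 2 ^ f l) \<le> of_nat (card {2..j}) * (2::nat) ^ T"
    proof (rule sum_bounded_above)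
      fix l assume "l \<in> {2..j}"
      then have "f l < T" using fT[OF f, of l] j by auto
      then show "(2::nat) ^ f l \<le> 2 ^ T" by (intro power_increasing) auto
    qed
    also have "\<dots> \<le> s * 2 ^ T" using j by (intro mult_right_mono) auto
    also have "\<dots> \<le> q" using T by (simp add: s_def)
    finally show ?thesis using f1[OF f] j by (auto simp: V_def)
  qed
  have inc: "V f j < V f (j + 1)" if f: "f \<in> Q" and j: "j \<in> {1..<r}" for f j
  proof -
    consider "j \<le> s" | "j = s + 1" | "s + 1 < j" by linarith
    then show ?thesis
    proof cases
      case 1
      then show ?thesis using step[of j f] j by simp
    next
      case 2
      then have "V f j \<le> 2 * q" using Vle[OF f, of j] by simp
      also have "\<dots> < V f (j + 1)" using fq[OF f, of "j + 1"] 2 j by (simp add: V_def)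
      finally show ?thesis .
    next
      case 3
      then have "V f j \<le> (j - s) * q + q" using fq[OF f, of j] j by (simp add: V_def)
      also have "\<dots> = (j + 1 - s) * q" using 3 by (simp add: Suc_diff_le)
      also have "\<dots> < V f (j + 1)" using fq[OF f, of "j + 1"] 3 j by (simp add: V_def)
      finally show ?thesis .
    qed
  qed
  have Vn: "V f j \<in> {1..n}" if f: "f \<in> Q" and j: "j \<in> {1..r}" for f j
  proof -
    have "V f j \<le> k * q"
    proof (cases "j \<le> s + 1")
      case True
      then have "V f j \<le> 2 * q" using Vle[OF f] j by simp
      also have "\<dots> \<le> k * q" using k by simp
      finally show ?thesis .
    next
      case False
      have "V f j \<le> (j - s) * q + q" using fq[OF f, of j] False j by (simp add: V_def)
      also have "\<dots> = (j - s + 1) * q" by simp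
      also have "\<dots> \<le> k * q" using False j rs k by (intro mult_right_mono) auto
      finally show ?thesis .
    qed
    moreover have "1 \<le> V f j" using f1[OF f] fq[OF f, of j] j by (auto simp: V_def)
    ultimately show ?thesis using q by simp
  qed
  have edge: "V f ` {1..r} \<in> edges (pow2_graph k r n)" if f: "f \<in> Q" for f
  proof -
    have "power_of_two (V f (j + 1) - V f j)" if "j \<in> {1..r - k + 1}" for j
      using step[of j f] that by (auto simp: s_def power_of_two_def)
    then show ?thesis using Vn[OF f] inc[OF f] unfolding pow2_graph_def
      by (auto intro!: exI[of _ "V f"])
  qed
  have "inj_on (\<lambda>f. V f ` {1..r}) Q"
  proof (rule inj_onI)
    fix f g assume f: "f \<in> Q" and g: "g \<in> Q" and "V f ` {1..r} = V g ` {1..r}"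
    \<comment> \<open>Equal edges have equal enumerations; exponents are then read off from
      consecutive differences and offsets from the last vertices.\<close>
    then have eq: "V f j = V g j" if "j \<in> {1..r}" for j
      using chain_eq_of_image_eq[of r "V f" "V g" j] inc that by blast
    have "f j = g j" if j: "j \<in> {1..r}" for j
    proof -
      consider "j = 1" | "j \<in> {2..s + 1}" | "s + 1 < j" using j by fastforce
      then show ?thesis
      proof cases
        case 1
        then show ?thesis using eq[of 1] j by (simp add: V_def)
      next
        case 2
        then have "V f (j - 1) = V g (j - 1)" using j by (intro eq) auto
        moreover have "j - 1 \<in> {1..s}" using 2 by auto
        ultimately have "(2::nat) ^ f j = 2 ^ g j"
          using step[of "j - 1" f] step[of "j - 1" g] eq[OF j] 2 by simp
        then show ?thesis by simp
      next
        case 3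
        then show ?thesis using eq[OF j] by (simp add: V_def)
      qed
    qed
    then show "f = g" using f g unfolding Q_def by (intro PiE_ext) auto
  qed
  then have "card Q \<le> card (edges (pow2_graph k r n))"
    by (rule card_inj_on_le) (use edge finite_edges_pow2_graph in auto)
  moreover have "card Q = q ^ (k - 1) * T ^ s"
  proof -
    have "card Q = (\<Prod>j\<in>{1..r}. card (F j))" unfolding Q_def by (rule card_PiE) simp
    also have "{1..r} = {2..s + 1} \<union> ({1} \<union> {s + 2..r})" using rs k by auto
    also have "(\<Prod>j\<in>\<dots>. card (F j)) = (\<Prod>j\<in>{2..s + 1}. card (F j)) * (\<Prod>j\<in>{1} \<union> {s + 2..r}. card (F j))"
      by (rule prod.union_disjoint) auto
    also have "(\<Prod>j\<in>{2..s + 1}. card (F j)) = (\<Prod>j\<in>{2..s + 1}. T)"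
      by (intro prod.cong) (auto simp: F_def)
    also have "(\<Prod>j\<in>{1} \<union> {s + 2..r}. card (F j)) = (\<Prod>j\<in>{1} \<union> {s + 2..r}. q)"
      by (intro prod.cong) (auto simp: F_def)
    also have "\<dots> = q ^ card ({1} \<union> {s + 2..r})" by simp
    also have "card ({1} \<union> {s + 2..r}) = k - 1" using rs k by simp
    finally show ?thesis by simp
  qed
  ultimately show ?thesis by (simp add: num_edges_def s_def)
qed

section \<open>Comparison of the two bounds\<close>

theorem mainTheorem8:
  fixes k r :: nat
  assumes "2 \<le> k" and "k < r"
  shows "\<exists>C::real. \<forall>n\<ge>2. \<forall>d::real.
           real (num_edges (pow2_graph k r n)) = d * real n ^ (k - 1) \<longrightarrow>
           (\<forall>m\<le>n. \<forall>H'. r_graph r H' \<and> subgraph H' (pow2_graph k r n) \<and>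
              interval_partite_of_size k m H' \<longrightarrow>
              real (num_edges H') \<le> C * (d * real m ^ (k - 1) / ln (real n)))"
proof -
  define s where "s = r - k + 1"
  \<comment> \<open>\<open>N\<close> bounds \<open>n\<close> in the range where the lower bound is
    not applied, and \<open>N ^ (k - 1) * N\<close> settles that range. \<open>K\<close> collects
    the constants for large \<open>n\<close>: \<open>4 ^ s\<close> comes from
    \<open>M = 4 * T\<close> and \<open>ln n \<le> 4 * T\<close>, and
    \<open>(2 * k) ^ (k - 1)\<close> from replacing \<open>q\<close> by \<open>n\<close>.\<close>
  define N :: real where "N = 4 ^ (k * s)"
  define K :: real where "K = real s * 4 * 4 ^ s * real r ^ (k - 2) * (2 * real k) ^ (k - 1)"
  have ks: "1 \<le> k * s" using assms by (simp add: s_def)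
  have N0: "0 \<le> N" and K0: "0 \<le> K" by (simp_all add: N_def K_def)
  show ?thesis
  proof (intro exI[of _ "N ^ (k - 1) * N + K"] allI impI, elim conjE)
    fix n m :: nat and d :: real and H' :: "nat hypergraph"
    assume n: "2 \<le> n" and d: "real (num_edges (pow2_graph k r n)) = d * real n ^ (k - 1)"
      and "m \<le> n" and H': "r_graph r H'" and sub: "subgraph H' (pow2_graph k r n)"
      and part: "interval_partite_of_size k m H'"
    have ln: "0 < ln (real n)" using n by simp
    have "0 \<le> d * real n ^ (k - 1)" using d[symmetric] by simp
    moreover have "0 < real n ^ (k - 1)" using n by simp
    ultimately have d0: "0 \<le> d" by (simp add: zero_le_mult_iff not_le[symmetric])
    define x where "x = d * real m ^ (k - 1)"
    have x0: "0 \<le> x" using d0 by (simp add: x_def)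
    have "real (num_edges H') * ln (real n) \<le> (N ^ (k - 1) * N + K) * x"
    proof -
      \<comment> \<open>Base 4 makes \<open>4 ^ T\<close> a product of two factors
        \<open>2 ^ T\<close>: for large \<open>T\<close> one absorbs \<open>k * s\<close>, the other
        bounds the gaps.\<close>
      obtain T where T: "4 ^ T \<le> n" "n < 4 ^ (T + 1)"
        using ex_power_ivl1[of 4 n] n by auto
      show ?thesis
      proof (cases "T < k * s")
        case True
        have "(4::nat) ^ (T + 1) \<le> 4 ^ (k * s)" using True by (intro power_increasing) auto
        then have "n \<le> 4 ^ (k * s)" using T(2) by linarith
        then have "real n \<le> real (4 ^ (k * s))" by (rule of_nat_mono)
        then have nN: "real n \<le> N" by (simp add: N_def)
        have "ln (real n) \<le> real n" using n ln_le_minus_one[of "real n"] by simp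
        then have lnN: "ln (real n) \<le> N" using nN by linarith
        show ?thesis
        proof (cases "m = 0")
          case True
          have "num_edges H' = 0"
            \<comment> \<open>For \<open>m = 0\<close> the estimate
              \<open>1 \<le> m ^ (k - 1)\<close> fails, but the upper bound has a factor
              \<open>m\<close>; here \<open>M = n\<close> serves, by
              \<open>n < 2 ^ n\<close>.\<close>
            using num_edges_interval_partite_le[OF assms less_exp H' sub part] True by simp
          then show ?thesis using x0 N0 K0 by simp
        next
          case False
          have "num_edges H' \<le> num_edges (pow2_graph k r n)"
            unfolding num_edges_def using sub
            by (intro card_mono finite_edges_pow2_graph) (simp add: subgraph_def)
          then have "real (num_edges H') \<le> d * real n ^ (k - 1)" using d by linarith
          also have "\<dots> \<le> d * N ^ (k - 1)"
            using d0 nN by (intro mult_left_mono power_mono) auto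
          also have "\<dots> \<le> d * N ^ (k - 1) * real m ^ (k - 1)"
            using False d0 N0 mult_left_mono[of 1 "real m ^ (k - 1)" "d * N ^ (k - 1)"] by simp
          finally have "real (num_edges H') * ln (real n) \<le> d * N ^ (k - 1) * real m ^ (k - 1) * N"
            using ln lnN d0 N0 by (intro mult_mono) auto
          also have "\<dots> = N ^ (k - 1) * N * x" by (simp add: x_def)
          also have "\<dots> \<le> (N ^ (k - 1) * N + K) * x" using x0 K0 by (intro mult_right_mono) auto
          finally show ?thesis .
        qed
      next
        case False
        then have T1: "1 \<le> T" using ks by linarith
        define q where "q = n div k"
        have kq: "k * q \<le> n" by (simp add: q_def)
        have "k * s \<le> 2 ^ T" using False less_exp[of T] by linarith
        then have "(k * s) * 2 ^ T \<le> 2 ^ T * 2 ^ T" by (rule mult_right_mono) simp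
        also have "\<dots> = 4 ^ T" by (simp flip: power_mult_distrib)
        also have "\<dots> \<le> n" by (rule T)
        finally have "s * 2 ^ T * k \<le> n" by (simp add: mult_ac)
        then have sq: "s * 2 ^ T \<le> q"
          using assms unfolding q_def by (simp add: less_eq_div_iff_mult_less_eq)
        moreover have "0 < s * 2 ^ T" by (simp add: s_def)
        ultimately have q1: "1 \<le> q" by linarith
        \<comment> \<open>Rounding down in \<open>n div k\<close> loses at most a factor 2, because
          \<open>q \<ge> 1\<close>.\<close>
        have "n < k * (q + 1)"
          using assms dividend_less_times_div[of k n] by (simp add: q_def)
        also have "\<dots> \<le> k * (2 * q)" using q1 by (intro mult_left_mono) auto
        finally have "real n \<le> real (k * (2 * q))" by (intro of_nat_mono) simp
        then have nq: "real n \<le> (2 * real k) * real q" by (simp add: mult_ac)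
        have "q ^ (k - 1) * T ^ s \<le> num_edges (pow2_graph k r n)"
          using num_edges_pow2_graph_ge[OF assms kq, of T] sq by (simp add: s_def)
        then have low: "real q ^ (k - 1) * real T ^ s \<le> d * real n ^ (k - 1)"
          unfolding d[symmetric] by (simp flip: of_nat_power of_nat_mult)
        \<comment> \<open>Passing from \<open>q\<close> to \<open>n\<close> and cancelling
          \<open>n ^ (k - 1)\<close> gives that \<open>d\<close> is at least of order
          \<open>T ^ s\<close>.\<close>
        have "real T ^ s * real n ^ (k - 1) \<le> real T ^ s * ((2 * real k) * real q) ^ (k - 1)"
          using nq by (intro mult_left_mono power_mono) auto
        also have "\<dots> = (2 * real k) ^ (k - 1) * (real q ^ (k - 1) * real T ^ s)"
          by (simp add: power_mult_distrib)
        also have "\<dots> \<le> (2 * real k) ^ (k - 1) * (d * real n ^ (k - 1))"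
          using low by (intro mult_left_mono) auto
        finally have "real T ^ s * real n ^ (k - 1) \<le> ((2 * real k) ^ (k - 1) * d) * real n ^ (k - 1)"
          by (simp add: mult_ac)
        then have Td: "real T ^ s \<le> (2 * real k) ^ (k - 1) * d"
          using n by (simp add: mult_le_cancel_right)
        have "(4::nat) ^ (T + 1) = 2 ^ (2 * (T + 1))" by (simp add: power_mult)
        also have "\<dots> \<le> 2 ^ (4 * T)" using T1 by (intro power_increasing) auto
        finally have nM: "n < 2 ^ (4 * T)" using T(2) by linarith
        then have "real n \<le> 2 ^ (4 * T)"
          by (metis less_imp_le of_nat_le_iff of_nat_numeral of_nat_power)
        then have "ln (real n) \<le> ln (2 ^ (4 * T))" using n by (subst ln_le_cancel_iff) auto
        also have "\<dots> = real (4 * T) * ln 2" by (simp add: ln_realpow)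
        also have "\<dots> \<le> real (4 * T) * 1"
          using ln_le_minus_one[of "2::real"] by (intro mult_left_mono) auto
        finally have lnT: "ln (real n) \<le> 4 * real T" by simp
        have "num_edges H' \<le> s * (4 * m * ((4 * T) ^ (r - k) * (r * m) ^ (k - 2)))"
          using num_edges_interval_partite_le[OF assms nM H' sub part] by (simp add: s_def)
        then have "real (num_edges H') \<le> real (s * (4 * m * ((4 * T) ^ (r - k) * (r * m) ^ (k - 2))))"
          by (rule of_nat_mono)
        \<comment> \<open>The factor \<open>ln n\<close> raises the power of \<open>4 * T\<close>
          from \<open>r - k = s - 1\<close> to \<open>s\<close>, exactly the power that
          \<open>d\<close> dominates.\<close>
        then have "real (num_edges H') * ln (real n)
            \<le> real (s * (4 * m * ((4 * T) ^ (r - k) * (r * m) ^ (k - 2)))) * (4 * real T)"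
          using lnT ln by (intro mult_mono) auto
        also have "\<dots> = real s * 4 * (4 * real T) ^ s * real r ^ (k - 2) * (real m * real m ^ (k - 2))"
        proof -
          have "(4 * real T) ^ s = (4 * real T) ^ (r - k) * (4 * real T)" by (simp add: s_def)
          then show ?thesis by (simp only: of_nat_mult of_nat_power power_mult_distrib) simp
        qed
        also have "real m * real m ^ (k - 2) = real m ^ (k - 1)"
        proof -
          have "k - 1 = Suc (k - 2)" using assms by simp
          then show ?thesis by simp
        qed
        also have "real s * 4 * (4 * real T) ^ s * real r ^ (k - 2) * real m ^ (k - 1)
            = (real s * 4 * 4 ^ s * real r ^ (k - 2) * real m ^ (k - 1)) * real T ^ s"
          by (simp add: power_mult_distrib)
        also have "\<dots> \<le> (real s * 4 * 4 ^ s * real r ^ (k - 2) * real m ^ (k - 1))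
            * ((2 * real k) ^ (k - 1) * d)"
          using Td by (intro mult_left_mono) auto
        also have "\<dots> = K * x" by (simp add: K_def x_def)
        also have "\<dots> \<le> (N ^ (k - 1) * N + K) * x" using x0 N0 by (intro mult_right_mono) auto
        finally show ?thesis .
      qed
    qed
    then show "real (num_edges H') \<le> (N ^ (k - 1) * N + K) * (d * real m ^ (k - 1) / ln (real n))"
      using ln by (simp add: x_def field_simps)
  qed
qed

end
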